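(* Let $\mathcal{A}$ be a unital $C^*$-algebra, let $\mathcal{F}\subseteq\mathcal{A}\cong B(\mathcal{A})$ be an ideal of finite type elements, and let $F\in B(\mathcal{A})$. Then $F\in\mathcal{M}\mathcal{K}{\Phi_{+}^{-}}'(\mathcal{A})$ if and only if there exist some $D\in B(\mathcal{A})$ and $K\in\mathcal{F}$ such that $F=D+K$ and $D$ is bounded below.
   Context: $\mathcal{A}$ is regarded as a right Hilbert module over itself and $B(\mathcal{A})$ is the $C^*$-algebra of all bounded $\mathcal{A}$-linear operators on $\mathcal{A}$ (all are adjointable). The map $a\mapsto L_a$ (left multiplication by $a$) is an isometric $*$-isomorphism $\mathcal{A}\to B(\mathcal{A})$, and $\mathcal{A}$ is identified with $B(\mathcal{A})$ through it; accordingly $\mathcal{F}$ is identified with its image in $B(\mathcal{A})$. Ideal of finite type elements: a subalgebra $\mathcal{F}\subseteq\mathcal{A}$ such that (i) $\mathcal{F}$ is a selfadjoint (two-sided) ideal in $\mathcal{A}$; (ii) there is an approximate unit $\{P_\alpha\}$ for $\mathcal{F}$, contained in $\mathcal{F}$, consisting of (orthogonal) projections; (iii) if $p,q\in\mathcal{F}$ are projections, then there exists $v\in\mathcal{A}$ such that $vv^*=q$ and $v^*v\perp p$, i.e. $v^*v+p$ is a projection as well. For closed submodules $M_1,M_2$ of a Hilbert module $M$, $M=M_1\tilde\oplus M_2$ means $M_1\cap M_2=\{0\}$ and $M_1+M_2=M$ (not necessarily orthogonal). A closed submodule is complementable if it is a summand in such a decomposition. Every closed complementable submodule $M$ of $\mathcal{A}$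 is orthogonally complementable; $P_M$ denotes the orthogonal projection onto $M$. An $\mathcal{M}\mathcal{K}\Phi_+$-decomposition for $F\in B(\mathcal{A})$ is a decomposition $\mathcal{A}=M_1\tilde\oplus N_1\stackrel{F}{\longrightarrow}M_2\tilde\oplus N_2=\mathcal{A}$ (closed submodules) with respect to which $F$ has the matrix $\begin{pmatrix}F_1&0\\0&F_4\end{pmatrix}$, where $F_1:M_1\to M_2$ is an isomorphism and $P_{N_1}\in\mathcal{F}$. Isomorphism (symbol $\cong$) means a bounded $\mathcal{A}$-linear bijection with bounded inverse. $F\in\mathcal{M}\mathcal{K}{\Phi_{+}^{-}}'(\mathcal{A})$ means that there exists an $\mathcal{M}\mathcal{K}\Phi_+$-decomposition $\mathcal{A}=M_1\tilde\oplus N_1\stackrel{F}{\longrightarrow}M_2\tilde\oplus N_2=\mathcal{A}$ for $F$ (that is, $F$ has the matrix $\begin{pmatrix}F_1&0\\0&F_4\end{pmatrix}$ with respect to it, with $F_1:M_1\to M_2$ an isomorphism and $P_{N_1}\in\mathcal{F}$) with $N_1\preceq N_2$, i.e. $N_1$ is isomorphic to a closed submodule of $N_2$. $D$ is bounded below if there is $c>0$ with $\|Dx\|\ge c\|x\|$ for all $x\in\mathcal{A}$. *)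

theory Defs
  imports "HOL-Analysis.Analysis"
begin

(* The class monoid_mult is used instead of ring_1 (and real_normed_algebra instead of
   real_normed_algebra_1) because the latter force 0 \<noteq> 1 and would exclude the zero algebra.
   Completeness, submultiplicativity of the norm and associativity are inherited. *)
class unital_cstar_algebra = real_normed_algebra + banach + monoid_mult +
  fixes scaleC :: "complex \<Rightarrow> 'a \<Rightarrow> 'a"  (infixr "*\<^sub>C" 75)
    and star :: "'a \<Rightarrow> 'a"
  assumes scaleR_scaleC: "r *\<^sub>R x = complex_of_real r *\<^sub>C x"
    and scaleC_add_right: "c *\<^sub>C (x + y) = c *\<^sub>C x + c *\<^sub>C y"
    and scaleC_add_left: "(c + d) *\<^sub>C x = c *\<^sub>C x + d *\<^sub>C x"
    and scaleC_scaleC: "c *\<^sub>C d *\<^sub>C x = (c * d) *\<^sub>C x"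
    and mult_scaleC_left: "(c *\<^sub>C x) * y = c *\<^sub>C (x * y)"
    and mult_scaleC_right: "x * (c *\<^sub>C y) = c *\<^sub>C (x * y)"
    and norm_scaleC: "norm (c *\<^sub>C x) = cmod c * norm x"
    and star_star: "star (star x) = x"
    and star_add: "star (x + y) = star x + star y"
    and star_scaleC: "star (c *\<^sub>C x) = cnj c *\<^sub>C star x"
    and star_mult: "star (x * y) = star y * star x"
    and cstar_identity: "norm (star x * x) = (norm x)\<^sup>2"

definition is_projection :: "'a::unital_cstar_algebra \<Rightarrow> bool" where
  "is_projection p \<longleftrightarrow> p * p = p \<and> star p = p"

definition subalgebra :: "'a::unital_cstar_algebra set \<Rightarrow> bool" where
  "subalgebra S \<longleftrightarrow> 0 \<in> S \<and> (\<forall>x\<in>S. \<forall>y\<in>S. x + y \<in> S \<and> x * y \<in> S) \<and>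
    (\<forall>c. \<forall>x\<in>S. c *\<^sub>C x \<in> S)"

definition selfadjoint_ideal :: "'a::unital_cstar_algebra set \<Rightarrow> bool" where
  "selfadjoint_ideal S \<longleftrightarrow> subalgebra S \<and> (\<forall>a. \<forall>x\<in>S. a * x \<in> S \<and> x * a \<in> S) \<and>
    (\<forall>x\<in>S. star x \<in> S)"

(* A net of projections in S is represented by its filter of tails, pushed forward to the
   algebra; conversely, every proper filter containing a set is the tail filter of a net
   in that set.  No monotonicity of the net is required. *)
definition has_projection_approximate_unit :: "'a::unital_cstar_algebra set \<Rightarrow> bool" where
  "has_projection_approximate_unit S \<longleftrightarrow>
    (\<exists>U. U \<noteq> bot \<and> U \<le> principal {p \<in> S. is_projection p} \<and>
      (\<forall>x\<in>S. ((\<lambda>p. p * x) \<longlongrightarrow> x) U \<and> ((\<lambda>p. x * p) \<longlongrightarrow> x) U))"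

definition finite_type_ideal :: "'a::unital_cstar_algebra set \<Rightarrow> bool" where
  "finite_type_ideal S \<longleftrightarrow> selfadjoint_ideal S \<and> has_projection_approximate_unit S \<and>
    (\<forall>p\<in>S. \<forall>q\<in>S. is_projection p \<longrightarrow> is_projection q \<longrightarrow>
      (\<exists>v. v * star v = q \<and> is_projection (star v * v + p)))"

(* The algebra as a right Hilbert module over itself; by the C*-identity the Hilbert module
   norm is the given one. *)
definition hinner :: "'a::unital_cstar_algebra \<Rightarrow> 'a \<Rightarrow> 'a" where
  "hinner x y = star x * y"

(* Closure under complex scalars is automatic: c x = x (c 1).  The same remark applies to
   complex linearity in bounded_module_map. *)
definition closed_submodule :: "'a::unital_cstar_algebra set \<Rightarrow> bool" where
  "closed_submodule M \<longleftrightarrow> closed M \<and> subspace M \<and> (\<forall>x\<in>M. \<forall>a. x * a \<in> M)"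

definition bounded_module_map ::
  "'a::unital_cstar_algebra set \<Rightarrow> 'a set \<Rightarrow> ('a \<Rightarrow> 'a) \<Rightarrow> bool" where
  "bounded_module_map M N f \<longleftrightarrow> f ` M \<subseteq> N \<and>
    (\<forall>x\<in>M. \<forall>y\<in>M. f (x + y) = f x + f y) \<and>
    (\<forall>x\<in>M. \<forall>a. f (x * a) = f x * a) \<and>
    (\<exists>C. \<forall>x\<in>M. norm (f x) \<le> C * norm x)"

definition module_iso ::
  "'a::unital_cstar_algebra set \<Rightarrow> 'a set \<Rightarrow> ('a \<Rightarrow> 'a) \<Rightarrow> bool" where
  "module_iso M N f \<longleftrightarrow> bij_betw f M N \<and> bounded_module_map M N f \<and>
    bounded_module_map N M (inv_into M f)"

definition bounded_operators :: "('a::unital_cstar_algebra \<Rightarrow> 'a) set" where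
  "bounded_operators = {T. bounded_module_map UNIV UNIV T}"

(* The identification of the algebra with its bounded operators. *)
definition left_mult :: "'a::unital_cstar_algebra \<Rightarrow> 'a \<Rightarrow> 'a" where
  "left_mult a = (\<lambda>x. a * x)"

definition is_orth_projection ::
  "'a::unital_cstar_algebra set \<Rightarrow> ('a \<Rightarrow> 'a) \<Rightarrow> bool" where
  "is_orth_projection M P \<longleftrightarrow> P \<in> bounded_operators \<and> P \<circ> P = P \<and> range P = M \<and>
    (\<forall>x y. hinner (P x) y = hinner x (P y))"

definition submodule_decomposition :: "'a::unital_cstar_algebra set \<Rightarrow> 'a set \<Rightarrow> bool" where
  "submodule_decomposition M N \<longleftrightarrow> closed_submodule M \<and> closed_submodule N \<and>
    M \<inter> N = {0} \<and> {x + y |x y. x \<in> M \<and> y \<in> N} = UNIV"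

(* The matrix of F is diagonal exactly if F maps M1 into M2 (part of module_iso) and N1
   into N2; its entries are then the restrictions of F.  Orthogonal projections onto a given
   submodule are unique, and N1, being complementable, has one. *)
definition MKPhi_plus_decomposition ::
  "'a::unital_cstar_algebra set \<Rightarrow> ('a \<Rightarrow> 'a) \<Rightarrow> 'a set \<Rightarrow> 'a set \<Rightarrow> 'a set \<Rightarrow> 'a set \<Rightarrow> bool"
where
  "MKPhi_plus_decomposition S F M1 N1 M2 N2 \<longleftrightarrow>
    submodule_decomposition M1 N1 \<and> submodule_decomposition M2 N2 \<and>
    module_iso M1 M2 F \<and> F ` N1 \<subseteq> N2 \<and>
    (\<exists>P. is_orth_projection N1 P \<and> P \<in> left_mult ` S)"

definition submodule_le :: "'a::unital_cstar_algebra set \<Rightarrow> 'a set \<Rightarrow> bool" where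
  "submodule_le N1 N2 \<longleftrightarrow> (\<exists>N f. closed_submodule N \<and> N \<subseteq> N2 \<and> module_iso N1 N f)"

definition MKPhi_plus_minus' :: "'a::unital_cstar_algebra set \<Rightarrow> ('a \<Rightarrow> 'a) set" where
  "MKPhi_plus_minus' S = {F \<in> bounded_operators. \<exists>M1 N1 M2 N2.
    MKPhi_plus_decomposition S F M1 N1 M2 N2 \<and> submodule_le N1 N2}"

definition bounded_below :: "('a::unital_cstar_algebra \<Rightarrow> 'a) \<Rightarrow> bool" where
  "bounded_below D \<longleftrightarrow> (\<exists>c>0. \<forall>x. norm (D x) \<ge> c * norm x)"

end

theory Submission
  imports Defs
begin

text \<open>
  Every bounded operator on the algebra is left multiplication by its value at \<open>1\<close>, so the
  statement is about elements \<open>f = d + k\<close> with \<open>k\<close> in the ideal.  In the same way, the oblique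
  projections of a decomposition into closed submodules are left multiplications by idempotents,
  the components of \<open>1\<close>, and are bounded for this trivial reason.

  Given a decomposition with an embedding \<open>i\<close> of \<open>N1\<close> into \<open>N2\<close>, let \<open>D\<close> be \<open>F\<close> on \<open>M1\<close> and \<open>i\<close> on
  \<open>N1\<close>.  It is bounded below because its two parts are and have their values in complementary
  submodules.  The difference \<open>F - D\<close> vanishes on \<open>M1\<close> and factors through the orthogonal
  projection onto \<open>N1\<close>, hence lies in the ideal.

  Conversely, let \<open>d\<close> be bounded below.  Then \<open>d\<close> has a left inverse \<open>g\<close>
  (\<open>bounded_below_left_invertible\<close>).  The approximate unit provides a projection \<open>p\<close> in the ideal
  for which \<open>g k (1 - p)\<close> has norm less than \<open>1\<close>, so that \<open>u = d + k (1 - p)\<close> still has a left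
  inverse, \<open>h\<close>.  Since \<open>f\<close> and \<open>u\<close> agree on the range of \<open>1 - p\<close>, the element \<open>f\<close> maps this range
  isomorphically onto a complemented submodule \<open>M2\<close>, whose complement \<open>N2\<close> can be chosen to
  contain \<open>u p A\<close>.  With respect to \<open>1 - p\<close>, \<open>p\<close> and \<open>M2\<close>, \<open>N2\<close> the matrix of \<open>f\<close> is upper
  triangular; replacing \<open>p A\<close> by the graph \<open>e A\<close> of a module map from \<open>p A\<close> to \<open>(1 - p) A\<close> makes it
  diagonal.  Now \<open>e A\<close>, \<open>p A\<close> and \<open>u p A\<close> are isomorphic.  The idempotent \<open>e = e p\<close> lies in the
  ideal, and so does the orthogonal projection onto \<open>e A\<close>, which has the form \<open>e r\<close>
  (\<open>idempotent_range_projection\<close>).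

  Both C*-algebraic inputs, the left inverse of \<open>d\<close> and the range projection of \<open>e\<close>, come down to
  the invertibility of \<open>t + m\<close> for skew-adjoint \<open>m\<close> and real \<open>t\<close>.  The real part of
  \<open>x* (t + m) x\<close> is \<open>t x* x\<close>, so \<open>t + m\<close> is bounded below by \<open>\<bar>t\<bar>\<close>, and a perturbation
  argument carries invertibility from large \<open>t\<close> down (\<open>skew_continuity_method\<close>).
\<close>

section \<open>The involution and the norm\<close>

lemma star_zero: "star (0::'a::unital_cstar_algebra) = 0"
  using star_add[of "0::'a" 0] by simp

lemma star_minus: "star (- x) = - star (x::'a::unital_cstar_algebra)"
  using star_add[of x "- x"] by (simp add: star_zero eq_neg_iff_add_eq_0 add.commute)

lemma star_diff: "star (x - y) = star x - star (y::'a::unital_cstar_algebra)"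
  using star_add[of x "- y"] by (simp add: star_minus)

lemma star_scaleR: "star (r *\<^sub>R x) = r *\<^sub>R star (x::'a::unital_cstar_algebra)"
  by (simp add: scaleR_scaleC star_scaleC)

lemma star_one: "star 1 = (1::'a::unital_cstar_algebra)"
  by (metis mult_1_right mult_1_left star_mult star_star)

lemma norm_star: "norm (star x) = norm (x::'a::unital_cstar_algebra)"
proof -
  have le: "norm y \<le> norm (star y)" for y :: 'a
  proof (cases "y = 0")
    case False
    have "norm y * norm y \<le> norm (star y) * norm y"
      using cstar_identity[of y] norm_mult_ineq[of "star y" y] by (simp add: power2_eq_square)
    then show ?thesis using False by simp
  qed simp
  from le[of x] le[of "star x"] show ?thesis by (simp add: star_star)
qed

section \<open>Invertible elements\<close>

definition invertible_elem :: "'a::monoid_mult \<Rightarrow> bool" where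
  "invertible_elem a \<longleftrightarrow> (\<exists>b. a * b = 1 \<and> b * a = 1)"

lemma invertible_elem_mult:
  "invertible_elem a \<Longrightarrow> invertible_elem b \<Longrightarrow> invertible_elem (a * b)"
  unfolding invertible_elem_def by (metis mult.assoc mult_1_left)

text \<open>
  Solving \<open>b' z = 1\<close> means solving the fixed point equation \<open>z = y (1 + (b - b') z)\<close>, where \<open>y\<close> is
  the inverse of \<open>b\<close>.  As \<open>y\<close> has norm at most \<open>1 / c\<close>, Banach's theorem applies.  The element \<open>b'\<close>
  is still bounded below, hence left cancellable, and a right inverse of it is a left inverse.
\<close>

lemma invertible_elem_perturb:
  fixes b b' :: "'a::unital_cstar_algebra"
  assumes inv: "invertible_elem b"
    and below: "\<And>x. c * norm x \<le> norm (b * x)"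
    and near: "norm (b' - b) < c"
  shows "invertible_elem b'"
proof -
  obtain y where y: "b * y = 1" "y * b = 1" using inv unfolding invertible_elem_def by blast
  have c: "c > 0" using near norm_ge_zero[of "b' - b"] by linarith
  have ynorm: "norm (y * x) \<le> norm x / c" for x
    using below[of "y * x"] y(1) c by (simp add: mult.assoc[symmetric] field_simps)
  define T where "T z = y * (1 + (b - b') * z)" for z
  define q where "q = norm (b' - b) / c"
  have q: "0 \<le> q" "q < 1" using near c by (auto simp: q_def)
  have "dist (T v) (T w) \<le> q * dist v w" for v w
  proof -
    have "T v - T w = y * ((b - b') * (v - w))" by (simp add: T_def algebra_simps)
    then have "dist (T v) (T w) \<le> norm ((b - b') * (v - w)) / c"
      using ynorm by (simp add: dist_norm)
    also have "\<dots> \<le> norm (b - b') * norm (v - w) / c"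
      using c by (intro divide_right_mono norm_mult_ineq) auto
    finally show ?thesis by (simp add: q_def dist_norm norm_minus_commute)
  qed
  then obtain z where "T z = z" using q banach_fix_type[of q T] by blast
  then have "b * z = 1 + (b - b') * z"
    using y(1) unfolding T_def by (metis mult.assoc mult_1_left)
  then have right: "b' * z = 1" by (simp add: algebra_simps)
  have "z * b' - 1 = 0"
  proof -
    define w where "w = z * b' - 1"
    have "b' * w = 0" using right by (simp add: w_def algebra_simps mult.assoc[symmetric])
    then have "b * w = (b - b') * w" by (simp add: algebra_simps)
    then have "c * norm w \<le> norm (b' - b) * norm w"
      using below[of w] norm_mult_ineq[of "b - b'" w] by (simp add: norm_minus_commute)
    then have "w = 0"
      using near mult_strict_right_mono[of "norm (b' - b)" c "norm w"] by fastforce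
    then show ?thesis by (simp add: w_def)
  qed
  then show ?thesis using right unfolding invertible_elem_def by auto
qed

section \<open>Skew-adjoint elements\<close>

text \<open>
  The element \<open>x* (t + m) x\<close> has real part \<open>t x* x\<close> and imaginary part \<open>x* m x\<close>, and real and
  imaginary parts do not exceed an element in norm.
\<close>

lemma skew_shift_bounds:
  fixes m :: "'a::unital_cstar_algebra"
  assumes skew: "star m = - m"
  shows "\<bar>t\<bar> * norm x \<le> norm ((t *\<^sub>R 1 + m) * x)"
    and "norm (star x * (m * x)) \<le> norm x * norm ((t *\<^sub>R 1 + m) * x)"
proof -
  define z where "z = star x * ((t *\<^sub>R 1 + m) * x)"
  have zsplit: "z = t *\<^sub>R (star x * x) + star x * (m * x)"
    by (simp add: z_def algebra_simps)
  have zstar: "star z = t *\<^sub>R (star x * x) - star x * (m * x)"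
    by (simp add: zsplit star_add star_scaleR star_mult star_star skew mult.assoc)
  have sum: "z + star z = 2 *\<^sub>R t *\<^sub>R (star x * x)"
    and diff: "z - star z = 2 *\<^sub>R (star x * (m * x))"
    unfolding zstar by (simp_all add: zsplit scaleR_2 scaleR_scaleR[symmetric] del: scaleR_scaleR)
  have znorm: "norm z \<le> norm x * norm ((t *\<^sub>R 1 + m) * x)"
    using norm_mult_ineq[of "star x" "(t *\<^sub>R 1 + m) * x"] by (simp add: z_def norm_star)
  have "norm (2 *\<^sub>R t *\<^sub>R (star x * x)) \<le> 2 * norm z"
    using norm_triangle_ineq[of z "star z"] sum by (simp add: norm_star)
  then have "\<bar>t\<bar> * (norm x * norm x) \<le> norm z"
    by (simp add: cstar_identity power2_eq_square)
  then have "norm x * (\<bar>t\<bar> * norm x) \<le> norm x * norm ((t *\<^sub>R 1 + m) * x)"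
    using znorm by (simp add: mult_ac)
  then show "\<bar>t\<bar> * norm x \<le> norm ((t *\<^sub>R 1 + m) * x)"
    by (cases "x = 0") auto
  have "norm (2 *\<^sub>R (star x * (m * x))) \<le> 2 * norm z"
    using norm_triangle_ineq4[of z "star z"] diff by (simp add: norm_star)
  then show "norm (star x * (m * x)) \<le> norm x * norm ((t *\<^sub>R 1 + m) * x)"
    using znorm by simp
qed

text \<open>
  For \<open>t > norm m\<close> the element \<open>t + m\<close> is a small perturbation of \<open>t\<close>.  The common lower bound \<open>c\<close>
  allows a decrease of \<open>t\<close> in steps of a fixed length \<open>s\<close> with \<open>s * norm 1 < c\<close> until \<open>t0\<close> is
  reached.
\<close>

lemma skew_continuity_method:
  fixes m :: "'a::unital_cstar_algebra"
  assumes skew: "star m = - m" and c: "c > 0"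
    and below: "\<And>t x. t \<ge> t0 \<Longrightarrow> c * norm x \<le> norm ((t *\<^sub>R 1 + m) * x)"
  shows "invertible_elem (t0 *\<^sub>R 1 + m)"
proof -
  define s where "s = c / (2 * (norm (1::'a) + 1))"
  have s: "s > 0" using c by (auto simp: s_def intro!: divide_pos_pos add_nonneg_pos)
  have step_small: "s * norm (1::'a) < c"
  proof -
    have "N \<ge> 0 \<Longrightarrow> c / (2 * (N + 1)) * N < c" for N :: real
      using c by (simp add: divide_simps add_nonneg_eq_0_iff)
    then show ?thesis by (simp add: s_def)
  qed
  have step: "invertible_elem (t *\<^sub>R 1 + m)"
    if "t \<ge> t0" and "invertible_elem ((t + s) *\<^sub>R 1 + m)" for t
  proof (rule invertible_elem_perturb[OF that(2)])
    show "c * norm x \<le> norm (((t + s) *\<^sub>R 1 + m) * x)" for x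
      using that(1) s by (intro below) auto
    have "t *\<^sub>R 1 + m - ((t + s) *\<^sub>R 1 + m) = - (s *\<^sub>R 1)" by (simp add: algebra_simps)
    then show "norm (t *\<^sub>R 1 + m - ((t + s) *\<^sub>R 1 + m)) < c" using step_small s by simp
  qed
  have descend: "t \<ge> t0 \<Longrightarrow> invertible_elem ((t + real n * s) *\<^sub>R 1 + m) \<Longrightarrow>
      invertible_elem (t *\<^sub>R 1 + m)" for n t
  proof (induction n arbitrary: t)
    case (Suc n)
    have "t + real (Suc n) * s = (t + s) + real n * s" by (simp add: algebra_simps)
    then have "invertible_elem (((t + s) + real n * s) *\<^sub>R 1 + m)"
      using Suc.prems(2) by (simp only:)
    moreover have "t + s \<ge> t0" using Suc.prems(1) s by simp
    ultimately have "invertible_elem ((t + s) *\<^sub>R 1 + m)" by (rule Suc.IH[rotated])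
    then show ?case using step Suc.prems by blast
  qed simp
  obtain n where "real n * s > norm m + \<bar>t0\<bar>"
    using reals_Archimedean3[OF s] by blast
  then have large: "t0 + real n * s > norm m" by linarith
  define t where "t = t0 + real n * s"
  have t: "t > 0" using large norm_ge_zero[of m] unfolding t_def by linarith
  have "invertible_elem (t *\<^sub>R 1 + m)"
  proof (rule invertible_elem_perturb[of "t *\<^sub>R 1" t])
    show "invertible_elem (t *\<^sub>R (1::'a))"
      unfolding invertible_elem_def using t by (intro exI[of _ "(1 / t) *\<^sub>R 1"]) simp
  qed (use large t in \<open>auto simp: t_def\<close>)
  then show ?thesis using descend[of t0 n] by (simp add: t_def)
qed

lemma one_plus_skew_invertible:
  fixes m :: "'a::unital_cstar_algebra"
  assumes "star m = - m"
  shows "invertible_elem (1 + m)"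
proof -
  have "invertible_elem (1 *\<^sub>R 1 + m)"
  proof (rule skew_continuity_method[OF assms, of 1])
    show "1 * norm x \<le> norm ((t *\<^sub>R 1 + m) * x)" if "t \<ge> 1" for t x
      using skew_shift_bounds(1)[OF assms, of t x] that
        mult_right_mono[of 1 t "norm x"] by simp
  qed simp
  then show ?thesis by simp
qed

text \<open>
  It suffices to invert \<open>d* d\<close>.  The path \<open>t + i d* d\<close> ends at \<open>i d* d\<close>, and on it the lower bound
  does not degenerate as \<open>t\<close> tends to \<open>0\<close>: the imaginary part of \<open>x* (t + i d* d) x\<close> has norm
  \<open>(norm (d x))\<^sup>2\<close>.
\<close>

lemma bounded_below_left_invertible:
  fixes d :: "'a::unital_cstar_algebra"
  assumes c: "c > 0" and below: "\<And>x. c * norm x \<le> norm (d * x)"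
  shows "\<exists>g. g * d = 1"
proof -
  define m where "m = \<i> *\<^sub>C (star d * d)"
  have "(- \<i>) *\<^sub>C (star d * d) + \<i> *\<^sub>C (star d * d) = 0"
    using scaleC_add_left[of "- \<i>" "\<i>" "star d * d"] scaleR_scaleC[of 0 "star d * d"] by simp
  then have skew: "star m = - m"
    by (simp add: m_def star_scaleC star_mult star_star eq_neg_iff_add_eq_0)
  have "invertible_elem (0 *\<^sub>R 1 + m)"
  proof (rule skew_continuity_method[OF skew, of "c\<^sup>2"])
    show "c\<^sup>2 * norm x \<le> norm ((t *\<^sub>R 1 + m) * x)" for t x
    proof -
      have "star x * (m * x) = \<i> *\<^sub>C (star (d * x) * (d * x))"
        by (simp add: m_def mult_scaleC_left mult_scaleC_right star_mult mult.assoc)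
      then have "norm (star x * (m * x)) = (norm (d * x))\<^sup>2"
        by (simp add: norm_scaleC cstar_identity)
      moreover have "(c * norm x)\<^sup>2 \<le> (norm (d * x))\<^sup>2"
        using below c by (intro power_mono) auto
      ultimately have "norm x * (c\<^sup>2 * norm x) \<le> norm x * norm ((t *\<^sub>R 1 + m) * x)"
        using skew_shift_bounds(2)[OF skew, of x t]
        by (simp add: power2_eq_square mult_ac)
      then show ?thesis by (cases "x = 0") auto
    qed
  qed (use c in auto)
  then obtain y where "y * m = 1" unfolding invertible_elem_def by auto
  then have "(\<i> *\<^sub>C (y * star d)) * d = 1"
    by (simp add: m_def mult_scaleC_left mult_scaleC_right mult.assoc)
  then show ?thesis by blast
qed

text \<open>
  Take the inverse \<open>r\<close> of \<open>s = e + e* - 1\<close>, which is invertible because \<open>s\<^sup>2\<close> is the product of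
  \<open>1 + m\<close> and \<open>1 - m\<close> for the skew-adjoint element \<open>m = e - e*\<close>.  From \<open>s e = e* e = e* s\<close> follows
  that \<open>e r = r e*\<close> is self-adjoint, and from \<open>e s = e e* = s e*\<close> that \<open>e r e = e e* r = e s r = e\<close>.
  These two identities say that \<open>e r\<close> is a projection with the same range as \<open>e\<close>.
\<close>

lemma idempotent_range_projection:
  fixes e :: "'a::unital_cstar_algebra"
  assumes idem: "e * e = e"
  shows "\<exists>r. is_projection (e * r) \<and> e * r * e = e"
proof -
  define m where "m = e - star e"
  define s where "s = e + star e - 1"
  have idem': "star e * star e = star e" using idem by (metis star_mult)
  have skew: "star m = - m" by (simp add: m_def star_diff star_star)
  have "star (- m) = - (- m)" using skew by (simp add: star_minus)
  from invertible_elem_mult[OF one_plus_skew_invertible[OF skew] one_plus_skew_invertible[OF this]]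
  have "invertible_elem ((1 + m) * (1 + - m))" .
  moreover have "(1 + m) * (1 + - m) = s * s"
    by (simp add: m_def s_def algebra_simps idem idem')
  ultimately obtain y where y: "s * s * y = 1" "y * (s * s) = 1"
    unfolding invertible_elem_def by auto
  define r where "r = s * y"
  have sr: "s * r = 1" using y by (simp add: r_def mult.assoc)
  have rs: "r * s = 1"
  proof -
    have "y * s * (s * r) = r" using y(2) by (metis mult.assoc mult_1_left)
    then have "r = y * s" by (simp add: sr)
    then show ?thesis using y(2) by (simp add: mult.assoc)
  qed
  have star_s: "star s = s" by (simp add: s_def star_add star_diff star_star star_one)
  have star_r: "star r = r"
    by (metis star_s sr rs star_mult star_one mult.assoc mult_1_left mult_1_right)
  have "s * e = star e * s" by (simp add: s_def algebra_simps idem idem')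
  then have re: "e * r = r * star e"
    by (metis sr rs mult.assoc mult_1_left mult_1_right)
  have "e * s = s * star e" by (simp add: s_def algebra_simps idem idem')
  then have re': "r * e = star e * r"
    by (metis sr rs mult.assoc mult_1_left mult_1_right)
  have es: "e * s = e * star e" by (simp add: s_def algebra_simps idem)
  have "e * r * e = e * star e * r" by (simp add: mult.assoc re')
  also have "\<dots> = e * (s * r)" by (simp add: es[symmetric] mult.assoc)
  finally have ere: "e * r * e = e" by (simp add: sr)
  then have "is_projection (e * r)"
    unfolding is_projection_def
    by (simp add: star_mult star_r re[symmetric] mult.assoc[symmetric])
  then show ?thesis using ere by blast
qed

section \<open>Module maps and submodules\<close>

lemma bounded_operator_left_mult:
  assumes "T \<in> bounded_operators"
  shows "T = left_mult (T 1)"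
proof
  fix x
  have "T (1 * x) = T 1 * x"
    using assms unfolding bounded_operators_def bounded_module_map_def by blast
  then show "T x = left_mult (T 1) x" by (simp add: left_mult_def)
qed

lemma bounded_module_map_left_mult:
  "(\<And>x. x \<in> M \<Longrightarrow> a * x \<in> N) \<Longrightarrow> bounded_module_map M N (left_mult a)"
  unfolding bounded_module_map_def left_mult_def
  by (auto simp: distrib_left mult.assoc intro: norm_mult_ineq)

lemma left_mult_bounded_operator: "left_mult a \<in> bounded_operators"
  by (simp add: bounded_operators_def bounded_module_map_left_mult)

lemma module_iso_left_mult:
  assumes subm: "closed_submodule N"
    and "\<And>x. x \<in> M \<Longrightarrow> a * x \<in> N" "\<And>y. y \<in> N \<Longrightarrow> b * y \<in> M"
    and "\<And>x. x \<in> M \<Longrightarrow> b * (a * x) = x" "\<And>y. y \<in> N \<Longrightarrow> a * (b * y) = y"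
  shows "module_iso M N (left_mult a)"
proof -
  have bij: "bij_betw (left_mult a) M N"
    by (rule bij_betw_byWitness[of _ "left_mult b"]) (use assms in \<open>auto simp: left_mult_def\<close>)
  have "inv_into M (left_mult a) y = left_mult b y" if "y \<in> N" for y
    using assms that bij
    by (intro inv_into_f_eq) (auto simp: left_mult_def bij_betw_def)
  moreover have "bounded_module_map N M (left_mult b)"
    using assms by (intro bounded_module_map_left_mult)
  ultimately have "bounded_module_map N M (inv_into M (left_mult a))"
    using subm by (auto simp: bounded_module_map_def closed_submodule_def subspace_add)
  then show ?thesis
    using bij assms(2) bounded_module_map_left_mult unfolding module_iso_def by blast
qed

lemma module_iso_bounded_below:
  assumes "module_iso M N f"
  shows "\<exists>C\<ge>0. \<forall>x\<in>M. norm x \<le> C * norm (f x)"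
proof -
  have "bounded_module_map N M (inv_into M f)" using assms by (simp add: module_iso_def)
  then obtain C where C: "\<forall>y\<in>N. norm (inv_into M f y) \<le> C * norm y"
    unfolding bounded_module_map_def by blast
  have "norm x \<le> \<bar>C\<bar> * norm (f x)" if "x \<in> M" for x
  proof -
    have "f x \<in> N" "inv_into M f (f x) = x"
      using assms that unfolding module_iso_def bij_betw_def by auto
    then have "norm x \<le> C * norm (f x)" using C by metis
    also have "\<dots> \<le> \<bar>C\<bar> * norm (f x)" by (intro mult_right_mono) auto
    finally show ?thesis .
  qed
  then show ?thesis by (intro exI[of _ "\<bar>C\<bar>"]) auto
qed

lemma closed_submodule_kernel: "closed_submodule {x::'a::unital_cstar_algebra. a * x = 0}"
proof -
  have "closed {x. a * x = 0}"
    by (intro closed_Collect_eq continuous_intros)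
  then show ?thesis
    unfolding closed_submodule_def
    by (auto simp: subspace_def distrib_left mult.assoc[symmetric])
qed

lemma closed_submodule_fixed: "closed_submodule {x::'a::unital_cstar_algebra. a * x = x}"
  using closed_submodule_kernel[of "a - 1"] by (simp add: left_diff_distrib)

lemma idempotent_decomposition:
  fixes e :: "'a::unital_cstar_algebra"
  assumes "e * e = e"
  shows "submodule_decomposition {x. e * x = 0} {x. e * x = x}"
    and "submodule_decomposition {x. e * x = x} {x. e * x = 0}"
proof -
  have "x = (x - e * x) + e * x" "x = e * x + (x - e * x)"
    "e * (x - e * x) = 0" "e * (e * x) = e * x" for x
    by (simp_all add: right_diff_distrib mult.assoc[symmetric] assms)
  then have "{x + y |x y. x \<in> {x. e * x = 0} \<and> y \<in> {x. e * x = x}} = UNIV"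
      "{x + y |x y. x \<in> {x. e * x = x} \<and> y \<in> {x. e * x = 0}} = UNIV"
    by blast+
  then show "submodule_decomposition {x. e * x = 0} {x. e * x = x}"
      "submodule_decomposition {x. e * x = x} {x. e * x = 0}"
    unfolding submodule_decomposition_def
    using closed_submodule_kernel closed_submodule_fixed by auto
qed

text \<open>
  The components of \<open>1\<close> represent the two projections of the decomposition: as \<open>M\<close> and \<open>N\<close> are
  right submodules, \<open>x = a x + b x\<close> is the decomposition of \<open>x\<close>.
\<close>

lemma decomposition_idempotents:
  fixes M N :: "'a::unital_cstar_algebra set"
  assumes "submodule_decomposition M N"
  obtains a b where "a \<in> M" "b \<in> N" "a + b = 1"
    "\<And>x. a * x \<in> M" "\<And>x. b * x \<in> N"
    "\<And>y z. y \<in> M \<Longrightarrow> z \<in> N \<Longrightarrow> a * (y + z) = y"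
    "\<And>y z. y \<in> M \<Longrightarrow> z \<in> N \<Longrightarrow> b * (y + z) = z"
proof -
  have M: "subspace M" "\<And>x a. x \<in> M \<Longrightarrow> x * a \<in> M"
    and N: "subspace N" "\<And>x a. x \<in> N \<Longrightarrow> x * a \<in> N" and MN: "M \<inter> N = {0}"
    and sum: "{x + y |x y. x \<in> M \<and> y \<in> N} = UNIV"
    using assms unfolding submodule_decomposition_def closed_submodule_def by auto
  have "1 \<in> {x + y |x y. x \<in> M \<and> y \<in> N}" using sum by simp
  then obtain a b where ab: "a \<in> M" "b \<in> N" "a + b = 1" by auto
  have split: "a * (y + z) = y \<and> b * (y + z) = z" if "y \<in> M" "z \<in> N" for y z
  proof -
    have "a * (y + z) + b * (y + z) = y + z"
      using ab(3) by (metis distrib_right mult_1_left)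
    then have eq: "y - a * (y + z) = b * (y + z) - z" by (simp add: algebra_simps)
    have "y - a * (y + z) \<in> M" using M ab that by (auto intro: subspace_diff)
    moreover have "b * (y + z) - z \<in> N" using N ab that by (auto intro: subspace_diff)
    ultimately have "y - a * (y + z) = 0" using MN by (metis IntI eq singletonD)
    moreover from this have "b * (y + z) - z = 0" using eq by (simp only:)
    ultimately show ?thesis by simp
  qed
  show ?thesis by (rule that[of a b]) (use ab M N split in auto)
qed

section \<open>The two implications\<close>

text \<open>
  The operator \<open>D\<close> is multiplication by \<open>d = f m + i n\<close>, where \<open>f = F 1\<close> and \<open>m\<close>,
  \<open>n\<close> are the components of \<open>1\<close> in \<open>M1\<close> and \<open>N1\<close>.  The components of \<open>1\<close> in \<open>M2\<close> and \<open>N2\<close> recover the two summands \<open>F (m x)\<close> and \<open>i (n x)\<close> from \<open>d x\<close>,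
  which gives the lower bound.
\<close>

lemma decomposition_imp_bounded_below_plus_ideal:
  fixes \<F> :: "'a::unital_cstar_algebra set"
  assumes ideal: "selfadjoint_ideal \<F>" and "F \<in> MKPhi_plus_minus' \<F>"
  shows "\<exists>D\<in>bounded_operators. \<exists>K\<in>left_mult ` \<F>. F = (\<lambda>x. D x + K x) \<and> bounded_below D"
proof -
  have \<F>: "\<And>a x. x \<in> \<F> \<Longrightarrow> a * x \<in> \<F>" "\<And>a x. x \<in> \<F> \<Longrightarrow> x * a \<in> \<F>"
    using ideal unfolding selfadjoint_ideal_def by auto
  obtain M1 N1 M2 N2 N i P p where F: "F \<in> bounded_operators"
    and dec1: "submodule_decomposition M1 N1" and dec2: "submodule_decomposition M2 N2"
    and isoF: "module_iso M1 M2 F" and isoi: "module_iso N1 N i" and "N \<subseteq> N2"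
    and P: "is_orth_projection N1 P" "P = left_mult p" and p: "p \<in> \<F>"
    using assms(2)
    unfolding MKPhi_plus_minus'_def MKPhi_plus_decomposition_def submodule_le_def
    by (elim CollectE conjE exE imageE) simp
  define f where "f = F 1"
  have Ff: "F x = f * x" for x
    using bounded_operator_left_mult[OF F] by (metis f_def left_mult_def)
  obtain m n where mn: "m \<in> M1" "n \<in> N1" "m + n = 1" "\<And>x. m * x \<in> M1" "\<And>x. n * x \<in> N1"
    using decomposition_idempotents[OF dec1] by metis
  obtain m' n' where mn':
      "\<And>y z. y \<in> M2 \<Longrightarrow> z \<in> N2 \<Longrightarrow> m' * (y + z) = y"
      "\<And>y z. y \<in> M2 \<Longrightarrow> z \<in> N2 \<Longrightarrow> n' * (y + z) = z"
    using decomposition_idempotents[OF dec2] by metis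
  have "P (P x) = P x" for x
    using P(1) unfolding is_orth_projection_def by (metis comp_apply)
  moreover have range: "range P = N1" using P(1) unfolding is_orth_projection_def by simp
  ultimately have "p * n = n" using mn(2) P(2) by (metis imageE left_mult_def)
  have pN1: "p \<in> N1" using range P(2) by (metis left_mult_def mult_1_right rangeI)
  have i: "i (x * a) = i x * a" if "x \<in> N1" for x a
    using isoi that unfolding module_iso_def bounded_module_map_def by blast
  define d where "d = f * m + i n"
  have "n \<in> \<F>" using \<F>(2)[OF p] \<open>p * n = n\<close> by metis
  then have "(f - i p) * n \<in> \<F>" by (rule \<F>(1))
  moreover have "f - d = (f - i p) * n"
  proof -
    \<comment> \<open>As \<open>p\<close> acts as the identity on \<open>N1\<close> and lies in it, \<open>i\<close> is multiplication by \<open>i p\<close>.\<close>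
    have "i n = i p * n" using i[OF pN1, of n] \<open>p * n = n\<close> by simp
    moreover have "f = f * m + f * n" using mn(3) by (metis distrib_left mult_1_right)
    ultimately show ?thesis by (simp add: d_def left_diff_distrib) (metis add_diff_cancel_left')
  qed
  ultimately have K: "f - d \<in> \<F>" by simp
  have dx: "d * x = F (m * x) + i (n * x)" for x
    using i[OF mn(2), of x] by (simp add: d_def Ff distrib_right mult.assoc)
  have below: "bounded_below (left_mult d)"
  proof -
    obtain C1 where C1: "C1 \<ge> 0" "\<And>x. x \<in> M1 \<Longrightarrow> norm x \<le> C1 * norm (F x)"
      using module_iso_bounded_below[OF isoF] by blast
    obtain C2 where C2: "C2 \<ge> 0" "\<And>x. x \<in> N1 \<Longrightarrow> norm x \<le> C2 * norm (i x)"
      using module_iso_bounded_below[OF isoi] by blast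
    define C where "C = C1 * norm m' + C2 * norm n' + 1"
    have C: "C > 0" using C1(1) C2(1) by (auto simp: C_def intro!: add_nonneg_pos)
    have "norm x \<le> C * norm (d * x)" for x
    proof -
      have FM: "F (m * x) \<in> M2" and iN: "i (n * x) \<in> N2"
        using isoF isoi \<open>N \<subseteq> N2\<close> mn(4,5) unfolding module_iso_def bij_betw_def by blast+
      have "norm (m * x) \<le> C1 * norm (m' * (d * x))"
        using C1(2)[OF mn(4)] mn'(1)[OF FM iN] by (simp add: dx)
      also have "\<dots> \<le> C1 * (norm m' * norm (d * x))"
        using C1(1) by (intro mult_left_mono norm_mult_ineq)
      finally have 1: "norm (m * x) \<le> C1 * (norm m' * norm (d * x))" .
      have "norm (n * x) \<le> C2 * norm (n' * (d * x))"
        using C2(2)[OF mn(5)] mn'(2)[OF FM iN] by (simp add: dx)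
      also have "\<dots> \<le> C2 * (norm n' * norm (d * x))"
        using C2(1) by (intro mult_left_mono norm_mult_ineq)
      finally have 2: "norm (n * x) \<le> C2 * (norm n' * norm (d * x))" .
      have "x = m * x + n * x" using mn(3) by (metis distrib_right mult_1_left)
      then have "norm x \<le> norm (m * x) + norm (n * x)" by (metis norm_triangle_ineq)
      also have "\<dots> \<le> C1 * (norm m' * norm (d * x)) + C2 * (norm n' * norm (d * x)) + norm (d * x)"
        using 1 2 norm_ge_zero[of "d * x"] by linarith
      finally show ?thesis by (simp add: C_def algebra_simps)
    qed
    then have "1 / C * norm x \<le> norm (left_mult d x)" for x
      using C by (simp add: left_mult_def field_simps)
    then show ?thesis using C unfolding bounded_below_def by (intro exI[of _ "1 / C"]) auto
  qed
  have "F = (\<lambda>x. left_mult d x + left_mult (f - d) x)"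
    by (simp add: fun_eq_iff Ff left_mult_def left_diff_distrib)
  then show ?thesis using below K left_mult_bounded_operator by blast
qed

text \<open>
  The decompositions are the kernels and ranges of two idempotents \<open>e\<close> and \<open>r = u (1 - p) h\<close>.
  Because \<open>h u = 1\<close>, the kernel of \<open>r\<close> contains \<open>u p A\<close>, and this is the submodule of \<open>N2\<close> to
  which \<open>N1 = e A\<close> is isomorphic, through multiplication by \<open>u p\<close> and back by \<open>e h\<close>.
\<close>

lemma bounded_below_plus_ideal_imp_decomposition:
  fixes \<F> :: "'a::unital_cstar_algebra set" and d k :: 'a
  assumes ideal: "selfadjoint_ideal \<F>" and unit: "has_projection_approximate_unit \<F>"
    and below: "bounded_below (left_mult d)" and k: "k \<in> \<F>"
  shows "left_mult (d + k) \<in> MKPhi_plus_minus' \<F>"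
proof -
  have \<F>: "\<And>a x. x \<in> \<F> \<Longrightarrow> a * x \<in> \<F>" "\<And>a x. x \<in> \<F> \<Longrightarrow> x * a \<in> \<F>"
    using ideal unfolding selfadjoint_ideal_def by auto
  obtain g where g: "g * d = 1"
    using below bounded_below_left_invertible unfolding bounded_below_def left_mult_def by blast
  obtain p where p: "p \<in> \<F>" "is_projection p" and close: "norm (g * k * p - g * k) < 1"
  proof -
    obtain U where U: "U \<noteq> bot" "U \<le> principal {p \<in> \<F>. is_projection p}"
      "((\<lambda>p. g * k * p) \<longlongrightarrow> g * k) U"
      using unit \<F>(1)[OF k] unfolding has_projection_approximate_unit_def by blast
    have "eventually (\<lambda>p. p \<in> \<F> \<and> is_projection p) U"
      using U(2) by (simp add: le_principal)
    moreover have "eventually (\<lambda>p. dist (g * k * p) (g * k) < 1) U"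
      using U(3) by (rule tendstoD) simp
    ultimately have "eventually (\<lambda>p. (p \<in> \<F> \<and> is_projection p) \<and> dist (g * k * p) (g * k) < 1) U"
      by (rule eventually_conj)
    then show ?thesis using eventually_happens'[OF U(1)] that by (auto simp: dist_norm)
  qed
  have pp: "p * p = p" using p(2) by (simp add: is_projection_def)
  define f where "f = d + k"
  define u where "u = d + k * (1 - p)"
  have gu: "g * u = 1 - (g * k * p - g * k)" by (simp add: u_def algebra_simps g)
  have "invertible_elem (g * u)"
    by (rule invertible_elem_perturb[of 1 1])
      (use close in \<open>auto simp: gu invertible_elem_def norm_minus_commute\<close>)
  then obtain v where "v * (g * u) = 1" unfolding invertible_elem_def by blast
  define h where "h = v * g"
  have hu: "h * u = 1" using \<open>v * (g * u) = 1\<close> by (simp add: h_def mult.assoc)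
  have hu': "h * (u * x) = x" for x by (metis hu mult.assoc mult_1_left)
  have pp': "p * (p * x) = p * x" for x by (metis pp mult.assoc)
  have fu: "f * x = u * x" if "p * x = 0" for x
    using that by (simp add: f_def u_def algebra_simps)
  \<comment> \<open>With upper row \<open>F1\<close>, \<open>F2\<close> in the triangular matrix of \<open>f\<close>, the product \<open>(1 - p) h f p\<close> is
    \<open>F1\<^sup>-\<^sup>1 F2\<close>.  Thus \<open>e\<close> projects along \<open>(1 - p) A\<close> onto the graph of \<open>- F1\<^sup>-\<^sup>1 F2\<close>, where the
    \<open>M2\<close>-component of \<open>f\<close> vanishes; \<open>r\<close> projects onto \<open>M2\<close> along \<open>N2\<close>.\<close>
  define e where "e = p - (1 - p) * h * f * p"
  define r where "r = u * (1 - p) * h"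
  have ep: "e * p = e" by (simp add: e_def left_diff_distrib mult.assoc pp)
  have pe: "p * e = p"
    by (simp add: e_def algebra_simps pp pp')
  have ee: "e * e = e" by (metis ep pe mult.assoc)
  have rr: "r * r = r"
    by (simp add: r_def algebra_simps pp pp' hu')
  have ker_e: "e * x = 0 \<longleftrightarrow> p * x = 0" for x
    by (metis ep pe mult.assoc mult_zero_right)
  have eF: "e \<in> \<F>" using \<F>(1)[OF p(1), of e] ep by simp
  have r_eq: "r * x = u * (h * x - p * (h * x))" for x
    by (simp add: r_def algebra_simps)
  let ?M1 = "{x. e * x = 0}" and ?N1 = "{x. e * x = x}"
    and ?M2 = "{x. r * x = x}" and ?N2 = "{x. r * x = 0}"
  have "module_iso ?M1 ?M2 (left_mult f)"
  proof (rule module_iso_left_mult[OF closed_submodule_fixed, where b = "(1 - p) * h"])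
    show "f * x \<in> ?M2" if "x \<in> ?M1" for x
      using that by (simp add: ker_e fu r_eq hu')
    show "(1 - p) * h * y \<in> ?M1" if "y \<in> ?M2" for y
      by (simp add: ker_e algebra_simps pp')
    show "(1 - p) * h * (f * x) = x" if "x \<in> ?M1" for x
      using that by (simp add: ker_e fu left_diff_distrib mult.assoc hu')
    show "f * ((1 - p) * h * y) = y" if "y \<in> ?M2" for y
    proof -
      have "p * ((1 - p) * h * y) = 0" by (simp add: algebra_simps pp')
      then show ?thesis using that by (simp add: fu r_def mult.assoc)
    qed
  qed
  moreover have "left_mult f ` ?N1 \<subseteq> ?N2"
  proof -
    have "r * (f * e) = 0"
    proof -
      define w where "w = (1 - p) * h * f * p"
      have "p * w = 0" by (simp add: w_def algebra_simps pp')
      then have "r * (f * w) = u * w" by (simp add: fu r_eq hu')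
      moreover have "r * (f * p) = u * w" by (simp add: w_def r_def mult.assoc)
      moreover have "e = p - w" by (simp add: e_def w_def)
      ultimately show ?thesis by (simp add: right_diff_distrib)
    qed
    then have "r * (f * x) = 0" if "e * x = x" for x
      using that by (metis mult.assoc mult_zero_left)
    then show ?thesis by (auto simp: left_mult_def)
  qed
  moreover have "\<exists>P. is_orth_projection ?N1 P \<and> P \<in> left_mult ` \<F>"
  proof -
    obtain s where s: "is_projection (e * s)" "e * s * e = e"
      using idempotent_range_projection[OF ee] by blast
    define q where "q = e * s"
    have q: "q * q = q" "star q = q" "q * e = e" "e * q = q"
      using s by (auto simp: q_def is_projection_def mult.assoc[symmetric] ee)
    have "range (left_mult q) = ?N1"
    proof (intro equalityI subsetI)
      show "x \<in> ?N1" if "x \<in> range (left_mult q)" for x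
        using that q(4) by (auto simp: left_mult_def mult.assoc[symmetric])
      show "x \<in> range (left_mult q)" if "x \<in> ?N1" for x
      proof -
        have "e * x = x" using that by simp
        then have "x = q * x" using q(3) mult.assoc[of q e x] by simp
        then show ?thesis unfolding left_mult_def by (rule range_eqI)
      qed
    qed
    moreover have "left_mult q \<circ> left_mult q = left_mult q"
      by (simp add: fun_eq_iff left_mult_def mult.assoc[symmetric] q)
    moreover have "hinner (left_mult q x) y = hinner x (left_mult q y)" for x y
      by (simp add: hinner_def left_mult_def star_mult q mult.assoc)
    ultimately have "is_orth_projection ?N1 (left_mult q)"
      unfolding is_orth_projection_def using left_mult_bounded_operator by blast
    moreover have "q \<in> \<F>" using \<F>(2)[OF eF] by (simp add: q_def)
    ultimately show ?thesis by blast
  qed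
  moreover have "submodule_le ?N1 ?N2"
  proof -
    let ?N = "{x. (u * p * h) * x = x}"
    have N: "?N \<subseteq> ?N2"
    proof
      fix x assume "x \<in> ?N"
      then have x: "u * (p * (h * x)) = x" by (simp add: mult.assoc)
      have "h * x = p * (h * x)" using hu'[of "p * (h * x)"] x by simp
      then show "x \<in> ?N2" by (simp add: r_eq)
    qed
    have "module_iso ?N1 ?N (left_mult (u * p))"
    proof (rule module_iso_left_mult[OF closed_submodule_fixed, where b = "e * h"])
      show "u * p * x \<in> ?N" for x by (simp add: mult.assoc hu' pp')
      show "e * h * y \<in> ?N1" for y by (simp add: mult.assoc[symmetric] ee)
      show "e * h * (u * p * x) = x" if "x \<in> ?N1" for x
      proof -
        have "e * (p * x) = x" using that ep mult.assoc[of e p x] by simp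
        then show ?thesis by (simp add: mult.assoc hu')
      qed
      show "u * p * (e * h * y) = y" if "y \<in> ?N" for y
      proof -
        have "p * (e * (h * y)) = p * (h * y)" using pe mult.assoc[of p e "h * y"] by simp
        then show ?thesis using that by (simp add: mult.assoc)
      qed
    qed
    then show ?thesis unfolding submodule_le_def using N closed_submodule_fixed by blast
  qed
  ultimately have "MKPhi_plus_decomposition \<F> (left_mult f) ?M1 ?N1 ?M2 ?N2"
    and "submodule_le ?N1 ?N2"
    using idempotent_decomposition(1)[OF ee] idempotent_decomposition(2)[OF rr]
    unfolding MKPhi_plus_decomposition_def by blast+
  then show ?thesis
    unfolding MKPhi_plus_minus'_def f_def using left_mult_bounded_operator by blast
qed

theorem proposition3p9:
  fixes \<F> :: "'a::unital_cstar_algebra set" and F :: "'a \<Rightarrow> 'a"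
  assumes "finite_type_ideal \<F>" and "F \<in> bounded_operators"
  shows "F \<in> MKPhi_plus_minus' \<F> \<longleftrightarrow>
    (\<exists>D\<in>bounded_operators. \<exists>K\<in>left_mult ` \<F>. F = (\<lambda>x. D x + K x) \<and> bounded_below D)"
proof
  have ideal: "selfadjoint_ideal \<F>" and unit: "has_projection_approximate_unit \<F>"
    using assms(1) unfolding finite_type_ideal_def by auto
  show "\<exists>D\<in>bounded_operators. \<exists>K\<in>left_mult ` \<F>. F = (\<lambda>x. D x + K x) \<and> bounded_below D"
    if "F \<in> MKPhi_plus_minus' \<F>"
    using decomposition_imp_bounded_below_plus_ideal[OF ideal that] .
  show "F \<in> MKPhi_plus_minus' \<F>"
    if sum: "\<exists>D\<in>bounded_operators. \<exists>K\<in>left_mult ` \<F>. F = (\<lambda>x. D x + K x) \<and> bounded_below D"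
  proof -
    obtain D k where D: "D \<in> bounded_operators" and k: "k \<in> \<F>"
      and F: "F = (\<lambda>x. D x + left_mult k x)" and below: "bounded_below D"
      using sum by (elim bexE imageE conjE) simp
    obtain d where d: "D = left_mult d" using bounded_operator_left_mult[OF D] by blast
    have "F = left_mult (d + k)"
      by (simp add: F d fun_eq_iff left_mult_def distrib_right)
    then show ?thesis
      using bounded_below_plus_ideal_imp_decomposition[OF ideal unit _ k] below d by simp
  qed
qed

end
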